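(* The set $\mathcal{C}\subset\mathcal{A}$ has non-empty interior in $\mathcal{A}$, with respect to the relative topology on $\mathcal{A}$ induced by the $C^1$-topology on $(\mathrm{Diff}^1_{\mathrm{im}}(I))^2$.
   Context: Let $I=[0,1]$ and let $\mathrm{Diff}^1_{\mathrm{im}}(I)$ be the set of $C^1$ maps $I\to I$ that are $C^1$-diffeomorphisms onto their images. The set $\mathcal{A}\subset(\mathrm{Diff}^1_{\mathrm{im}}(I))^2$ consists of the pairs $(f,g)$ with: $f(0)=0$ and $g(1)=1$; $f(x)<x<g(x)$ for all $x\in(0,1)$; $0<g(0)<f(1)<1$. For $(f,g)\in\mathcal{A}$ put $W=[g(0),f(1)]=f(I)\cap g(I)$, $F_n=[f^{n+1}(1),f^n(1)]$, $G_n=[g^n(0),g^{n+1}(0)]$ (powers denote iterates). $\mathrm{int}(X)$ denotes the interior of $X$. Property $\mathsf{So}$ (single overlapping): $W$ is contained in the interior of $F_1\cup G_1$; equivalently $f^2(1)<g(0)$ and $f(1)<g^2(0)$. Property $\mathsf{Ho}$ (hole; for pairs satisfying $\mathsf{So}$): there are closed intervals $H_f\subset\mathrm{int}(F_1\setminus W)$ and $H_g\subset\mathrm{int}(G_1\setminus W)$ with non-empty interior such that $g(H_f)=H_g$ and $f(H_g)=H_f$. Induced maps: $\mathcal{F}:F_1\setminus\{f(1)\}\to G_1$ is $\mathcal{F}(x)=g^{-n(x)}(f^{-1}(x))$, where $n(x)$ is the least non-negative integer with $g^{-n(x)}(f^{-1}(x))\in G_1$. Similarly $\mathcal{G}:G_1\setminus\{g(0)\}\to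 F_1$ is $\mathcal{G}(x)=f^{-m(x)}(g^{-1}(x))$, where $m(x)$ is the least non-negative integer with $f^{-m(x)}(g^{-1}(x))\in F_1$. Both are piecewise $C^1$. Property $\mathsf{Ee}$ (eventual expansion): there is $\mu>1$ such that $\mathcal{F}'(y)>\mu$ for every $y\in F_1\setminus H_f$ at which $\mathcal{F}'(y)$ makes sense, and $\mathcal{G}'(y)>\mu$ for every $y\in G_1\setminus H_g$ at which $\mathcal{G}'(y)$ makes sense. Property $\mathsf{Ca}$ (castration): with $R_f=\mathcal{F}^{-1}(H_g)\subset F_1$ and $R_g=\mathcal{G}^{-1}(H_f)\subset G_1$, one has $W\subset\mathrm{int}(R_f)\cup\mathrm{int}(R_g)$. $\mathcal{C}$ is the set of pairs $(f,g)\in\mathcal{A}$ satisfying $\mathsf{So}$, $\mathsf{Ho}$, $\mathsf{Ee}$ and $\mathsf{Ca}$ (the last two with respect to the intervals $H_f,H_g$ of $\mathsf{Ho}$). *)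

theory Defs
  imports "HOL-Analysis.Analysis"
begin

text \<open>Derivatives are taken within the set, hence are one-sided at the endpoints of an interval.\<close>

definition C1_on :: "real set \<Rightarrow> (real \<Rightarrow> real) \<Rightarrow> bool" where
  "C1_on S f \<longleftrightarrow>
     (\<exists>f'. (\<forall>x\<in>S. (f has_real_derivative f' x) (at x within S)) \<and> continuous_on S f')"

text \<open>Maps of the unit interval are represented by functions on the reals that are
  \<^const>\<open>undefined\<close> outside \<open>{0..1}\<close>, so that equality is equality of maps.\<close>

definition Diff1_im :: "(real \<Rightarrow> real) set" where
  "Diff1_im = {f \<in> extensional {0..1}.
     f ` {0..1} \<subseteq> {0..1} \<and> inj_on f {0..1} \<and>
     C1_on {0..1} f \<and> C1_on (f ` {0..1}) (inv_into {0..1} f)}"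

definition D01 :: "(real \<Rightarrow> real) \<Rightarrow> real \<Rightarrow> real" where
  "D01 f x = vector_derivative f (at x within {0..1})"

text \<open>The value 0 off \<open>Diff1_im\<close> is irrelevant; \<^locale>\<open>Metric_space\<close> requires the distance to be
  non-negative everywhere.\<close>

definition C1_dist :: "(real \<Rightarrow> real) \<Rightarrow> (real \<Rightarrow> real) \<Rightarrow> real" where
  "C1_dist f g =
     (if f \<in> Diff1_im \<and> g \<in> Diff1_im
      then (SUP x\<in>{0..1}. \<bar>f x - g x\<bar>) + (SUP x\<in>{0..1}. \<bar>D01 f x - D01 g x\<bar>)
      else 0)"

definition C1_topology :: "(real \<Rightarrow> real) topology" where
  "C1_topology = Metric_space.mtopology Diff1_im C1_dist"

definition A_pairs :: "((real \<Rightarrow> real) \<times> (real \<Rightarrow> real)) set" where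
  "A_pairs = {(f, g). f \<in> Diff1_im \<and> g \<in> Diff1_im \<and>
     f 0 = 0 \<and> g 1 = 1 \<and> (\<forall>x\<in>{0<..<1}. f x < x \<and> x < g x) \<and>
     0 < g 0 \<and> g 0 < f 1 \<and> f 1 < 1}"

definition W_ivl :: "(real \<Rightarrow> real) \<Rightarrow> (real \<Rightarrow> real) \<Rightarrow> real set" where
  "W_ivl f g = {g 0..f 1}"

definition F_ivl :: "(real \<Rightarrow> real) \<Rightarrow> nat \<Rightarrow> real set" where
  "F_ivl f n = {(f ^^ (n + 1)) 1..(f ^^ n) 1}"

definition G_ivl :: "(real \<Rightarrow> real) \<Rightarrow> nat \<Rightarrow> real set" where
  "G_ivl g n = {(g ^^ n) 0..(g ^^ (n + 1)) 0}"

definition So :: "(real \<Rightarrow> real) \<Rightarrow> (real \<Rightarrow> real) \<Rightarrow> bool" where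
  "So f g \<longleftrightarrow> W_ivl f g \<subseteq> interior (F_ivl f 1 \<union> G_ivl g 1)"

definition Ho :: "(real \<Rightarrow> real) \<Rightarrow> (real \<Rightarrow> real) \<Rightarrow> real set \<Rightarrow> real set \<Rightarrow> bool" where
  "Ho f g Hf Hg \<longleftrightarrow>
     (\<exists>a b. a < b \<and> Hf = {a..b}) \<and> (\<exists>c d. c < d \<and> Hg = {c..d}) \<and>
     Hf \<subseteq> interior (F_ivl f 1 - W_ivl f g) \<and> Hg \<subseteq> interior (G_ivl g 1 - W_ivl f g) \<and>
     g ` Hf = Hg \<and> f ` Hg = Hf"

text \<open>For \<open>(f, g) \<in> A_pairs\<close> and \<open>x\<close> in \<open>dom_F f\<close>, the point \<open>f\<^sup>-\<^sup>1 x\<close> lies in \<open>[f 1, 1)\<close>, which is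
  contained in \<open>[g 0, 1)\<close>, the union of the intervals \<open>G_ivl g n\<close> with \<open>n \<ge> 1\<close>. Hence the backward
  orbit under \<open>g\<close> stays in the image of \<open>g\<close> until it first meets \<open>G_ivl g 1\<close>: the least number
  exists, and the inverses are evaluated only inside the images. Likewise with \<open>f\<close> and \<open>g\<close>
  exchanged. Outside the domains \<open>dom_F f\<close> and \<open>dom_G g\<close> the values have no meaning.\<close>

abbreviation inv01 :: "(real \<Rightarrow> real) \<Rightarrow> real \<Rightarrow> real" where
  "inv01 f \<equiv> inv_into {0..1} f"

definition dom_F :: "(real \<Rightarrow> real) \<Rightarrow> real set" where
  "dom_F f = F_ivl f 1 - {f 1}"

definition dom_G :: "(real \<Rightarrow> real) \<Rightarrow> real set" where
  "dom_G g = G_ivl g 1 - {g 0}"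

definition n_time :: "(real \<Rightarrow> real) \<Rightarrow> (real \<Rightarrow> real) \<Rightarrow> real \<Rightarrow> nat" where
  "n_time f g x = (LEAST n. (inv01 g ^^ n) (inv01 f x) \<in> G_ivl g 1)"

definition m_time :: "(real \<Rightarrow> real) \<Rightarrow> (real \<Rightarrow> real) \<Rightarrow> real \<Rightarrow> nat" where
  "m_time f g x = (LEAST m. (inv01 f ^^ m) (inv01 g x) \<in> F_ivl f 1)"

definition induced_F :: "(real \<Rightarrow> real) \<Rightarrow> (real \<Rightarrow> real) \<Rightarrow> real \<Rightarrow> real" where
  "induced_F f g x = (inv01 g ^^ n_time f g x) (inv01 f x)"

definition induced_G :: "(real \<Rightarrow> real) \<Rightarrow> (real \<Rightarrow> real) \<Rightarrow> real \<Rightarrow> real" where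
  "induced_G f g x = (inv01 f ^^ m_time f g x) (inv01 g x)"

text \<open>The derivatives of the induced maps make sense at a point of the domain if they exist there
  relative to the domain: two-sided in the interior, so break points are skipped, and one-sided
  at the endpoint that belongs to the domain.\<close>

definition Ee :: "(real \<Rightarrow> real) \<Rightarrow> (real \<Rightarrow> real) \<Rightarrow> real set \<Rightarrow> real set \<Rightarrow> bool" where
  "Ee f g Hf Hg \<longleftrightarrow> (\<exists>\<mu>>1.
     (\<forall>y\<in>dom_F f - Hf. \<forall>D. (induced_F f g has_real_derivative D) (at y within dom_F f) \<longrightarrow> D > \<mu>) \<and>
     (\<forall>y\<in>dom_G g - Hg. \<forall>D. (induced_G f g has_real_derivative D) (at y within dom_G g) \<longrightarrow> D > \<mu>))"

definition R_f :: "(real \<Rightarrow> real) \<Rightarrow> (real \<Rightarrow> real) \<Rightarrow> real set \<Rightarrow> real set" where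
  "R_f f g Hg = {x \<in> dom_F f. induced_F f g x \<in> Hg}"

definition R_g :: "(real \<Rightarrow> real) \<Rightarrow> (real \<Rightarrow> real) \<Rightarrow> real set \<Rightarrow> real set" where
  "R_g f g Hf = {x \<in> dom_G g. induced_G f g x \<in> Hf}"

definition Ca :: "(real \<Rightarrow> real) \<Rightarrow> (real \<Rightarrow> real) \<Rightarrow> real set \<Rightarrow> real set \<Rightarrow> bool" where
  "Ca f g Hf Hg \<longleftrightarrow> W_ivl f g \<subseteq> interior (R_f f g Hg) \<union> interior (R_g f g Hf)"

definition C_pairs :: "((real \<Rightarrow> real) \<times> (real \<Rightarrow> real)) set" where
  "C_pairs = {(f, g) \<in> A_pairs. So f g \<and>
     (\<exists>Hf Hg. Ho f g Hf Hg \<and> Ee f g Hf Hg \<and> Ca f g Hf Hg)}"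


lemma D01_eqI:
  assumes "(f has_real_derivative d) (at x within {0..1})" "x \<in> {0..1}"
  shows "D01 f x = d"
  unfolding D01_def
  using assms by (intro vector_derivative_within_cbox[of 0 1, simplified])
    (auto simp: has_real_derivative_iff_has_vector_derivative)

lemma Diff1_im_continuous:
  assumes "f \<in> Diff1_im"
  shows "continuous_on {0..1} f" "continuous_on {0..1} (D01 f)"
proof -
  obtain f' where f': "\<And>x. x \<in> {0..1} \<Longrightarrow> (f has_real_derivative f' x) (at x within {0..1})"
    "continuous_on {0..1} f'"
    using assms unfolding Diff1_im_def C1_on_def by blast
  show "continuous_on {0..1} f"
    using f'(1) DERIV_continuous_on by blast
  have "\<And>x. x \<in> {0..1} \<Longrightarrow> D01 f x = f' x"
    using D01_eqI f'(1) by blast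
  then show "continuous_on {0..1} (D01 f)"
    using f'(2) continuous_on_cong by metis
qed

lemma bdd_above_abs_diff:
  fixes u v :: "real \<Rightarrow> real"
  assumes "continuous_on {0..1} u" "continuous_on {0..1} v"
  shows "bdd_above ((\<lambda>x. \<bar>u x - v x\<bar>) ` {0..1})"
  by (intro bounded_imp_bdd_above compact_imp_bounded compact_continuous_image
      continuous_intros assms compact_Icc)

lemma SUP_abs_diff_nonneg:
  fixes u v :: "real \<Rightarrow> real"
  assumes "continuous_on {0..1} u" "continuous_on {0..1} v"
  shows "0 \<le> (SUP x\<in>{0..1}. \<bar>u x - v x\<bar>)"
  using cSUP_upper[OF _ bdd_above_abs_diff[OF assms], of 0] by force

lemma SUP_abs_diff_triangle:
  fixes u v w :: "real \<Rightarrow> real"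
  assumes "continuous_on {0..1} u" "continuous_on {0..1} v" "continuous_on {0..1} w"
  shows "(SUP x\<in>{0..1}. \<bar>u x - w x\<bar>) \<le> (SUP x\<in>{0..1}. \<bar>u x - v x\<bar>) + (SUP x\<in>{0..1}. \<bar>v x - w x\<bar>)"
proof (rule cSUP_least)
  fix x :: real assume x: "x \<in> {0..1}"
  have "\<bar>u x - v x\<bar> \<le> (SUP x\<in>{0..1}. \<bar>u x - v x\<bar>)" "\<bar>v x - w x\<bar> \<le> (SUP x\<in>{0..1}. \<bar>v x - w x\<bar>)"
    using cSUP_upper[OF x bdd_above_abs_diff] assms by auto
  then show "\<bar>u x - w x\<bar> \<le> (SUP x\<in>{0..1}. \<bar>u x - v x\<bar>) + (SUP x\<in>{0..1}. \<bar>v x - w x\<bar>)"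
    by linarith
qed simp

lemma Metric_space_C1: "Metric_space Diff1_im C1_dist"
proof
  note c = Diff1_im_continuous
  have nn: "0 \<le> (SUP x\<in>{0..1}. \<bar>f x - g x\<bar>)" "0 \<le> (SUP x\<in>{0..1}. \<bar>D01 f x - D01 g x\<bar>)"
    if "f \<in> Diff1_im" "g \<in> Diff1_im" for f g
    using SUP_abs_diff_nonneg c that by auto
  show "C1_dist f g = 0 \<longleftrightarrow> f = g" if fg: "f \<in> Diff1_im" "g \<in> Diff1_im" for f g
  proof
    assume "C1_dist f g = 0"
    then have 0: "(SUP x\<in>{0..1}. \<bar>f x - g x\<bar>) = 0"
      using nn[OF fg] fg unfolding C1_dist_def by simp
    have "f x = g x" if x: "x \<in> {0..1}" for x
      using cSUP_upper[OF x bdd_above_abs_diff[OF c(1)[OF fg(1)] c(1)[OF fg(2)]]] 0 by simp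
    then show "f = g"
      using fg unfolding Diff1_im_def by (auto intro: extensionalityI)
  qed (simp add: C1_dist_def)
  show "C1_dist f h \<le> C1_dist f g + C1_dist g h"
    if "f \<in> Diff1_im" "g \<in> Diff1_im" "h \<in> Diff1_im" for f g h
    using SUP_abs_diff_triangle[OF c(1) c(1) c(1), OF that]
      SUP_abs_diff_triangle[OF c(2) c(2) c(2), OF that] that
    unfolding C1_dist_def by simp
  show "C1_dist f g = C1_dist g f" for f g
    by (simp add: C1_dist_def abs_minus_commute)
  show "0 \<le> C1_dist f g" for f g
    using nn by (simp add: C1_dist_def)
qed

lemma So_iff:
  assumes "(f, g) \<in> A_pairs"
  shows "So f g \<longleftrightarrow> f (f 1) < g 0 \<and> f 1 < g (g 0)"
proof -
  have lt: "f (f 1) < f 1" "g 0 < g (g 0)" "g 0 < f 1"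
    using assms by (auto simp: A_pairs_def)
  have ivl: "F_ivl f 1 = {f (f 1)..f 1}" "G_ivl g 1 = {g 0..g (g 0)}" "W_ivl f g = {g 0..f 1}"
    by (simp_all add: F_ivl_def G_ivl_def W_ivl_def)
  show ?thesis
  proof
    assume so: "So f g"
    let ?U = "{f (f 1)..f 1} \<union> {g 0..g (g 0)}"
    have "g 0 \<in> interior ?U" "f 1 \<in> interior ?U"
      using so lt unfolding So_def ivl by auto
    then obtain d e where de: "d > 0" "cball (g 0) d \<subseteq> ?U" "e > 0" "cball (f 1) e \<subseteq> ?U"
      unfolding mem_interior_cball by blast
    have "g 0 - d \<in> cball (g 0) d" "f 1 + e \<in> cball (f 1) e"
      using de(1,3) by (auto simp: dist_real_def)
    then have "g 0 - d \<in> ?U" "f 1 + e \<in> ?U"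
      using de(2,4) by blast+
    then show "f (f 1) < g 0 \<and> f 1 < g (g 0)"
      using de(1,3) lt by auto
  next
    assume *: "f (f 1) < g 0 \<and> f 1 < g (g 0)"
    have "{f (f 1)<..<g (g 0)} \<subseteq> interior ({f (f 1)..f 1} \<union> {g 0..g (g 0)})"
      using lt by (intro interior_maximal) auto
    then show "So f g"
      using * unfolding So_def ivl by force
  qed
qed

end

theory Submission
  imports Defs
begin


text \<open>
  Ideas of the proof. All four conditions follow from finitely many strict bounds on the values of
  \<open>f\<close> and \<open>g\<close> at given points and on their first derivatives over given intervals, so it is enough to
  find one pair for which these bounds hold with some room to spare.

  Hole. If \<open>a\<close> and \<open>b\<close> are fixed points of \<open>f \<circ> g\<close>, then \<open>H\<^sub>f = [a, b]\<close> and
  \<open>H\<^sub>g = [g a, g b]\<close> are exchanged by \<open>g\<close> and \<open>f\<close>. The fixed points survive perturbation: when \<open>g\<close>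
  maps a small interval \<open>J\<close> into \<open>J'\<close> and \<open>f\<close> maps \<open>J'\<close> back into the interior of \<open>J\<close>, then every
  pair that is uniformly close has a fixed point of \<open>f \<circ> g\<close> in \<open>J\<close>
  (\<open>two_cycle_exists\<close>). The hole moves with the pair, but its endpoints stay in small windows.

  Eventual expansion. Near each point of its domain, at least on one side, \<open>\<F>\<close> is the inverse of
  \<open>f \<circ> g\<^sup>n\<close> for a fixed \<open>n\<close>. Where \<open>\<F>\<close> has a derivative, that derivative is therefore the reciprocal
  of a product of derivatives of \<open>f\<close> and \<open>g\<close> along an orbit segment
  (\<open>inverse_branch_derivative_ge\<close>). The segment never visits \<open>H\<^sub>f\<close> when \<open>g\<close> is applied, and it ends in
  \<open>H\<^sub>g\<close>, where \<open>f\<close> is applied, only if the point itself is in \<open>H\<^sub>f\<close>. Hence all that is needed is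
  that the derivatives of \<open>f\<close> off \<open>H\<^sub>g\<close> and of \<open>g\<close> off \<open>H\<^sub>f\<close> are at most some \<open>\<kappa> < 1\<close>. The
  infinitely many branches cause no loss, as a longer segment only adds factors below 1.

  Castration. The branches with exponent 1 give \<open>f (g H\<^sub>g) \<subseteq> R\<^sub>f\<close> and \<open>g (f H\<^sub>f) \<subseteq> R\<^sub>g\<close>. These are
  two intervals, and they cover \<open>W\<close> under three strict inequalities among the
  endpoints involved.

  The lemma \<open>in_C_pairs\<close> collects these criteria. The model pair is
  symmetric under \<open>x \<mapsto> 1 - x\<close>. Its \<open>f\<close> has slope \<open>1/4\<close> outside \<open>[6/10, 8/10]\<close>, with \<open>f 0 = 0\<close> and
  \<open>f 1 = 51/100\<close>, and climbs steeply in between. That interval lies in \<open>H\<^sub>g\<close>, where the expansion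
  condition asks for nothing. The equations \<open>f (1 - b) = a\<close> and \<open>f (1 - a) = b\<close> give
  \<open>a \<approx> 0.1307\<close> and \<open>b \<approx> 0.4773\<close>; then \<open>W = [0.49, 0.51]\<close> is covered by
  \<open>f (g H\<^sub>g) \<approx> [0.4802, 0.5018]\<close> and its mirror image. The climb is what makes this
  possible: it separates \<open>a\<close> and \<open>b\<close> by a large factor although \<open>f\<close> contracts elsewhere, so that a
  single component of each of \<open>R\<^sub>f\<close> and \<open>R\<^sub>g\<close> reaches across half of \<open>W\<close>. All inequalities hold with a margin
  that allows a \<open>C\<^sup>1\<close>-distance of \<open>1/10000\<close> in each coordinate.
\<close>

section \<open>Embeddings of the unit interval and their iterates\<close>

lemma Diff1_imD:
  assumes "f \<in> Diff1_im"
  shows "inj_on f {0..1}" "\<And>x. x \<in> {0..1} \<Longrightarrow> f x \<in> {0..1}"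
    "\<And>x. x \<in> {0..1} \<Longrightarrow> (f has_real_derivative D01 f x) (at x within {0..1})"
proof -
  show "inj_on f {0..1}" "\<And>x. x \<in> {0..1} \<Longrightarrow> f x \<in> {0..1}"
    using assms unfolding Diff1_im_def by blast+
  obtain f' where "\<And>x. x \<in> {0..1} \<Longrightarrow> (f has_real_derivative f' x) (at x within {0..1})"
    using assms unfolding Diff1_im_def C1_on_def by blast
  then show "\<And>x. x \<in> {0..1} \<Longrightarrow> (f has_real_derivative D01 f x) (at x within {0..1})"
    using D01_eqI by metis
qed

lemma D01_pos_imp_increasing:
  assumes "f \<in> Diff1_im" "\<And>x. x \<in> {0..1} \<Longrightarrow> 0 < D01 f x"
    and "0 \<le> x" "x < y" "y \<le> 1"
  shows "f x < f y"
proof (rule DERIV_pos_imp_increasing_open[OF \<open>x < y\<close>])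
  fix t assume t: "x < t" "t < y"
  then have "t \<in> {0..1}" and i: "t \<in> interior {0..1}"
    using assms by auto
  then show "\<exists>d. (f has_real_derivative d) (at t) \<and> 0 < d"
    using Diff1_imD(3)[OF assms(1)] assms(2) at_within_interior[OF i] by metis
next
  show "continuous_on {x..y} f"
    using Diff1_im_continuous(1)[OF assms(1)] by (rule continuous_on_subset) (use assms in auto)
qed

lemma has_field_derivative_transform:
  assumes "x \<in> S" "\<And>x. x \<in> S \<Longrightarrow> g x = f x" "(f has_field_derivative D) (at x within S)"
  shows "(g has_field_derivative D) (at x within S)"
  using has_derivative_transform[of x S g f] assms unfolding has_field_derivative_def by blast

lemma iterate_mem: "(\<And>x. x \<in> S \<Longrightarrow> h x \<in> S) \<Longrightarrow> x \<in> S \<Longrightarrow> (h ^^ n) x \<in> S"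
  by (induction n) auto

lemma continuous_on_iterate:
  assumes "continuous_on S h" "\<And>x. x \<in> S \<Longrightarrow> h x \<in> S"
  shows "continuous_on S (h ^^ n)"
proof (induction n)
  case (Suc n)
  have "(h ^^ n) ` S \<subseteq> S"
    using iterate_mem[of S h] assms(2) by blast
  then have "continuous_on S (h \<circ> (h ^^ n))"
    using Suc assms(1) by (meson continuous_on_compose continuous_on_subset)
  then show ?case by simp
qed (simp add: id_def)

section \<open>Branches of the induced maps\<close>

text \<open>
  Both induced maps have the form \<open>x \<mapsto> \<psi>\<^sup>-\<^sup>n (\<phi>\<^sup>-\<^sup>1 x)\<close> with \<open>n\<close> the first time of entering \<open>S\<close>. Going
  backwards from \<open>\<phi> (\<psi>\<^sup>n u)\<close> with \<open>u \<in> S\<close> retraces the forward orbit of \<open>u\<close>, so if that orbit leaves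
  \<open>S\<close> at once and stays outside up to time \<open>n\<close>, then the entry time is \<open>n\<close> and the value is \<open>u\<close>. In this form no inverse is
  ever evaluated outside an image.
\<close>

lemma first_entry_of_backward_orbit:
  assumes "inj_on \<phi> {0..1}" "inj_on \<psi> {0..1}" "\<And>x. x \<in> {0..1} \<Longrightarrow> \<psi> x \<in> {0..1}"
    and "u \<in> {0..1}" "u \<in> S" "\<And>j. 0 < j \<Longrightarrow> j \<le> n \<Longrightarrow> (\<psi> ^^ j) u \<notin> S"
  shows "(LEAST k. (inv01 \<psi> ^^ k) (inv01 \<phi> (\<phi> ((\<psi> ^^ n) u))) \<in> S) = n"
    and "(inv01 \<psi> ^^ n) (inv01 \<phi> (\<phi> ((\<psi> ^^ n) u))) = u"
proof -
  have mem: "(\<psi> ^^ j) u \<in> {0..1}" for j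
    using assms(3,4) by (rule iterate_mem)
  have orbit: "(inv01 \<psi> ^^ k) (inv01 \<phi> (\<phi> ((\<psi> ^^ n) u))) = (\<psi> ^^ (n - k)) u" if "k \<le> n" for k
    using that
  proof (induction k)
    case 0
    then show ?case using mem assms(1) by simp
  next
    case (Suc k)
    then have "(\<psi> ^^ (n - k)) u = \<psi> ((\<psi> ^^ (n - Suc k)) u)"
      using Suc_diff_Suc[of k n] by (metis Suc_le_lessD comp_apply funpow.simps(2))
    then show ?case using Suc mem assms(2) by simp
  qed
  then show "(inv01 \<psi> ^^ n) (inv01 \<phi> (\<phi> ((\<psi> ^^ n) u))) = u" by simp
  show "(LEAST k. (inv01 \<psi> ^^ k) (inv01 \<phi> (\<phi> ((\<psi> ^^ n) u))) \<in> S) = n"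
  proof (rule Least_equality)
    fix k assume k: "(inv01 \<psi> ^^ k) (inv01 \<phi> (\<phi> ((\<psi> ^^ n) u))) \<in> S"
    show "n \<le> k"
    proof (rule ccontr)
      assume "\<not> n \<le> k"
      then have "0 < n - k" "n - k \<le> n" "k \<le> n" by auto
      then show False using k orbit[of k] assms(6) by metis
    qed
  qed (use orbit assms(5) in simp)
qed

lemma iterate_derivative:
  assumes "\<psi> \<in> Diff1_im" "u \<in> {0..1}"
    and "\<And>j. j < n \<Longrightarrow> 0 < D01 \<psi> ((\<psi> ^^ j) u) \<and> D01 \<psi> ((\<psi> ^^ j) u) \<le> 1"
  obtains d where "((\<psi> ^^ n) has_real_derivative d) (at u within {0..1})" "0 < d" "d \<le> 1"
proof -
  have "\<exists>d. ((\<psi> ^^ n) has_real_derivative d) (at u within {0..1}) \<and> 0 < d \<and> d \<le> 1"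
    using assms(3)
  proof (induction n)
    case 0
    then show ?case by (auto simp: id_def intro!: exI[of _ 1] DERIV_ident)
  next
    case (Suc n)
    then obtain d where d: "((\<psi> ^^ n) has_real_derivative d) (at u within {0..1})" "0 < d" "d \<le> 1"
      by force
    let ?e = "D01 \<psi> ((\<psi> ^^ n) u)"
    have mem: "(\<psi> ^^ n) x \<in> {0..1}" if "x \<in> {0..1}" for x
      using Diff1_imD(2)[OF assms(1)] that by (rule iterate_mem)
    have "(\<psi> ^^ n) ` {0..1} \<subseteq> {0..1}" using mem by blast
    with Diff1_imD(3)[OF assms(1) mem[OF assms(2)]]
    have "(\<psi> has_real_derivative ?e) (at ((\<psi> ^^ n) u) within (\<psi> ^^ n) ` {0..1})"
      by (rule DERIV_subset)
    then have "(\<psi> \<circ> (\<psi> ^^ n) has_real_derivative ?e * d) (at u within {0..1})"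
      using d(1) by (rule DERIV_image_chain)
    moreover have "0 < ?e" "?e \<le> 1" using Suc.prems[of n] by auto
    ultimately show ?case
      using d by (auto intro!: exI[of _ "?e * d"] simp: mult_le_one comp_def)
  qed
  then show thesis using that by blast
qed

text \<open>
  The function \<open>\<Phi>\<close> is a left inverse of \<open>\<phi> \<circ> \<psi>\<^sup>n\<close> on \<open>K\<close>, which may lie on one side of \<open>u\<close> only. By
  the chain rule within \<open>K\<close>, any derivative of \<open>\<Phi>\<close> at the image point times the derivative of \<open>\<phi> \<circ> \<psi>\<^sup>n\<close> at \<open>u\<close> is 1. This
  covers break points of \<open>\<Phi>\<close> as well.
\<close>

lemma inverse_branch_derivative_ge:
  assumes "\<phi> \<in> Diff1_im" "\<psi> \<in> Diff1_im" "K \<subseteq> {0..1}" "u \<in> K" "u islimpt K"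
    and branch: "\<And>v. v \<in> K \<Longrightarrow> \<phi> ((\<psi> ^^ n) v) \<in> T \<and> \<Phi> (\<phi> ((\<psi> ^^ n) v)) = v"
    and last: "0 < D01 \<phi> ((\<psi> ^^ n) u)" "D01 \<phi> ((\<psi> ^^ n) u) \<le> \<kappa>"
    and orbit: "\<And>j. j < n \<Longrightarrow> 0 < D01 \<psi> ((\<psi> ^^ j) u) \<and> D01 \<psi> ((\<psi> ^^ j) u) \<le> 1"
    and D: "(\<Phi> has_real_derivative D) (at (\<phi> ((\<psi> ^^ n) u)) within T)"
  shows "1 / \<kappa> \<le> D"
proof -
  have u: "u \<in> {0..1}" using assms by auto
  obtain d where d: "((\<psi> ^^ n) has_real_derivative d) (at u within {0..1})" "0 < d" "d \<le> 1"
    using iterate_derivative[OF assms(2) u orbit] by blast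
  let ?e = "D01 \<phi> ((\<psi> ^^ n) u)"
  have mem: "(\<psi> ^^ n) x \<in> {0..1}" if "x \<in> {0..1}" for x
    using Diff1_imD(2)[OF assms(2)] that by (rule iterate_mem)
  have "(\<psi> ^^ n) ` {0..1} \<subseteq> {0..1}" using mem by blast
  with Diff1_imD(3)[OF assms(1) mem[OF u]]
  have "(\<phi> has_real_derivative ?e) (at ((\<psi> ^^ n) u) within (\<psi> ^^ n) ` {0..1})"
    by (rule DERIV_subset)
  then have "(\<phi> \<circ> (\<psi> ^^ n) has_real_derivative ?e * d) (at u within {0..1})"
    using d(1) by (rule DERIV_image_chain)
  then have h: "(\<phi> \<circ> (\<psi> ^^ n) has_real_derivative ?e * d) (at u within K)"
    using assms(3) by (rule DERIV_subset)
  have "(\<phi> \<circ> (\<psi> ^^ n)) ` K \<subseteq> T" using branch by auto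
  from DERIV_subset[OF D this]
  have "(\<Phi> has_real_derivative D) (at ((\<phi> \<circ> (\<psi> ^^ n)) u) within (\<phi> \<circ> (\<psi> ^^ n)) ` K)"
    by simp
  then have "(\<Phi> \<circ> (\<phi> \<circ> (\<psi> ^^ n)) has_real_derivative D * (?e * d)) (at u within K)"
    using h by (rule DERIV_image_chain)
  then have "((\<lambda>v. v) has_real_derivative D * (?e * d)) (at u within K)"
    by (rule has_field_derivative_transform[OF \<open>u \<in> K\<close>, rotated]) (simp add: branch)
  moreover have "((\<lambda>v. v) has_real_derivative 1) (at u within K)" by (rule DERIV_ident)
  moreover have "at u within K \<noteq> bot" using assms(5) by (simp add: trivial_limit_within)
  ultimately have De: "D * (?e * d) = 1" using has_field_derivative_unique by blast
  have pos: "0 < ?e * d" and "?e * d \<le> ?e"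
    using last d by (auto simp: mult_left_le)
  then have le: "?e * d \<le> \<kappa>" using last by linarith
  have "D = 1 / (?e * d)" using De pos by (intro eq_divide_imp) auto
  then show ?thesis using pos le by (simp add: frac_le)
qed

section \<open>Fundamental domains\<close>

text \<open>The orbit decreases, and its limit is a fixed point in \<open>[0, 1)\<close>, of which 0 is the only one.\<close>

lemma iterates_tendsto_zero:
  fixes f :: "real \<Rightarrow> real"
  assumes cont: "continuous_on {0..1} f" and im: "\<And>x. x \<in> {0..1} \<Longrightarrow> f x \<in> {0..1}"
    and "f 0 = 0" and below: "\<And>x. x \<in> {0<..<1} \<Longrightarrow> f x < x" and z: "0 \<le> z" "z < 1"
  shows "(\<lambda>n. (f ^^ n) z) \<longlonglongrightarrow> 0"
proof -
  have le: "f x \<le> x" if "x \<in> {0..<1}" for x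
    using that below[of x] \<open>f 0 = 0\<close> by (cases "x = 0") auto
  have mem: "(f ^^ n) z \<in> {0..z}" for n
  proof (rule iterate_mem)
    fix x assume "x \<in> {0..z}"
    then show "f x \<in> {0..z}" using le[of x] im[of x] z by auto
  qed (use z in auto)
  have "decseq (\<lambda>n. (f ^^ n) z)"
    using mem le z by (intro decseq_SucI) fastforce
  then obtain L where L: "(\<lambda>n. (f ^^ n) z) \<longlonglongrightarrow> L"
    by (rule decseq_convergent[where B = 0]) (use mem in auto)
  have L01: "L \<in> {0..z}"
    using mem by (intro closed_sequentially[OF _ _ L]) auto
  have "(\<lambda>n. f ((f ^^ n) z)) \<longlonglongrightarrow> f L"
    using mem L01 z by (intro continuous_on_tendsto_compose[OF cont L]) (auto intro!: always_eventually order_trans[OF _ less_imp_le[OF z(2)]])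
  moreover have "(\<lambda>n. f ((f ^^ n) z)) \<longlonglongrightarrow> L"
    using LIMSEQ_Suc[OF L] by simp
  ultimately have "f L = L" using LIMSEQ_unique by blast
  then have "L = 0" using below[of L] L01 z by (cases "L = 0") auto
  then show ?thesis using L by simp
qed

text \<open>
  The orbit of \<open>c\<close> decreases to 0, so \<open>z\<close> lies between two consecutive points \<open>f\<^sup>m\<^sup>+\<^sup>1 c\<close> and \<open>f\<^sup>m c\<close>. The
  intermediate value theorem for \<open>f\<^sup>m\<close> on \<open>[f c, c]\<close> yields \<open>u\<close>.
\<close>

lemma fundamental_domain_below:
  fixes f :: "real \<Rightarrow> real"
  assumes cont: "continuous_on {0..1} f" and im: "\<And>x. x \<in> {0..1} \<Longrightarrow> f x \<in> {0..1}"
    and "f 0 = 0" and below: "\<And>x. x \<in> {0<..<1} \<Longrightarrow> f x < x" and c: "c < 1" and z: "0 < z" "z < c"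
  obtains m u where "f c \<le> u" "u < c" "(f ^^ m) u = z"
proof -
  have "\<exists>n. (f ^^ n) c < z"
    using order_tendstoD(2)[OF iterates_tendsto_zero[OF cont im \<open>f 0 = 0\<close> below] z(1), of c] z c
    by (auto simp: eventually_sequentially)
  then have ex: "\<exists>n. (f ^^ n) c \<le> z" by (auto intro: less_imp_le)
  define N where "N = (LEAST n. (f ^^ n) c \<le> z)"
  have N: "(f ^^ N) c \<le> z" unfolding N_def using ex by (rule LeastI_ex)
  then obtain m where m: "N = Suc m" using z by (cases N) auto
  have "\<not> (f ^^ m) c \<le> z"
    using not_less_Least[of m "\<lambda>n. (f ^^ n) c \<le> z"] m unfolding N_def by simp
  moreover have "(f ^^ m) (f c) \<le> z" using N m by (simp add: funpow_swap1)
  moreover have "continuous_on {f c..c} (f ^^ m)"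
    using continuous_on_iterate[OF cont im]
    by (rule continuous_on_subset) (use im[of c] c z in auto)
  ultimately obtain u where u: "f c \<le> u" "u \<le> c" "(f ^^ m) u = z"
    using IVT'[of "f ^^ m" "f c" z c] below[of c] c z by force
  then have "u \<noteq> c" using \<open>\<not> (f ^^ m) c \<le> z\<close> by auto
  then show thesis using that u by force
qed

text \<open>The mirror image of the previous lemma under \<open>x \<mapsto> 1 - x\<close>.\<close>

lemma fundamental_domain_above:
  fixes g :: "real \<Rightarrow> real"
  assumes cont: "continuous_on {0..1} g" and im: "\<And>x. x \<in> {0..1} \<Longrightarrow> g x \<in> {0..1}"
    and "g 1 = 1" and above: "\<And>x. x \<in> {0<..<1} \<Longrightarrow> x < g x" and c: "0 < c" and z: "c < z" "z < 1"
  obtains n u where "c < u" "u \<le> g c" "(g ^^ n) u = z"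
proof -
  define h where "h x = 1 - g (1 - x)" for x
  have iter: "(h ^^ n) x = 1 - (g ^^ n) (1 - x)" for n x
    by (induction n) (auto simp: h_def)
  have "continuous_on {0..1} h"
    unfolding h_def by (intro continuous_intros continuous_on_compose2[OF cont]) auto
  moreover have "h x \<in> {0..1}" if "x \<in> {0..1}" for x
    using im[of "1 - x"] that by (auto simp: h_def)
  moreover have "h 0 = 0" using \<open>g 1 = 1\<close> by (simp add: h_def)
  moreover have "h x < x" if "x \<in> {0<..<1}" for x
    using above[of "1 - x"] that by (auto simp: h_def)
  ultimately obtain n u where "h (1 - c) \<le> u" "u < 1 - c" "(h ^^ n) u = 1 - z"
    by (rule fundamental_domain_below[of h "1 - c" "1 - z"]) (use c z in auto)
  then show thesis by (intro that[of "1 - u" n]) (auto simp: iter h_def)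
qed



section \<open>Pairs with a single overlap\<close>

text \<open>
  Positivity of the derivatives gives strict monotonicity, which turns images of intervals into
  intervals between the images of the endpoints. The two inequalities of \<open>overlap\<close> are property \<open>So\<close>.
\<close>

locale overlapping_pair =
  fixes f g :: "real \<Rightarrow> real"
  assumes A: "(f, g) \<in> A_pairs"
    and f_pos: "\<And>x. x \<in> {0..1} \<Longrightarrow> 0 < D01 f x"
    and g_pos: "\<And>x. x \<in> {0..1} \<Longrightarrow> 0 < D01 g x"
    and overlap: "f (f 1) < g 0" "f 1 < g (g 0)"
begin

lemma Diff1: "f \<in> Diff1_im" "g \<in> Diff1_im"
  using A by (auto simp: A_pairs_def)

lemmas f_mono = D01_pos_imp_increasing[OF Diff1(1) f_pos]
lemmas g_mono = D01_pos_imp_increasing[OF Diff1(2) g_pos]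
lemmas f_im = Diff1_imD(2)[OF Diff1(1)]
lemmas g_im = Diff1_imD(2)[OF Diff1(2)]
lemmas f_cont = Diff1_im_continuous(1)[OF Diff1(1)]
lemmas g_cont = Diff1_im_continuous(1)[OF Diff1(2)]

lemma ends: "f 0 = 0" "g 1 = 1" "0 < g 0" "g 0 < f 1" "f 1 < 1" "0 < f (f 1)" "g (g 0) < 1"
    "f (f 1) < f 1" "g 0 < g (g 0)"
proof -
  show *: "f 0 = 0" "g 1 = 1" "0 < g 0" "g 0 < f 1" "f 1 < 1" "f (f 1) < f 1" "g 0 < g (g 0)"
    using A by (auto simp: A_pairs_def)
  show "0 < f (f 1)" "g (g 0) < 1"
    using f_mono[of 0 "f 1"] g_mono[of "g 0" 1] * by auto
qed

lemma below: "x \<in> {0<..<1} \<Longrightarrow> f x < x" and above: "x \<in> {0<..<1} \<Longrightarrow> x < g x"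
  using A by (auto simp: A_pairs_def)

lemma f_mono': "0 \<le> x \<Longrightarrow> x \<le> y \<Longrightarrow> y \<le> 1 \<Longrightarrow> f x \<le> f y"
  using f_mono[of x y] by (cases "x = y") auto

lemma g_mono': "0 \<le> x \<Longrightarrow> x \<le> y \<Longrightarrow> y \<le> 1 \<Longrightarrow> g x \<le> g y"
  using g_mono[of x y] by (cases "x = y") auto

lemma intervals: "F_ivl f 1 = {f (f 1)..f 1}" "G_ivl g 1 = {g 0..g (g 0)}" "W_ivl f g = {g 0..f 1}"
    "dom_F f = {f (f 1)..<f 1}" "dom_G g = {g 0<..g (g 0)}"
  using ends by (auto simp: F_ivl_def G_ivl_def W_ivl_def dom_F_def dom_G_def)

lemma g_iterate_ge: "g 0 < u \<Longrightarrow> u < 1 \<Longrightarrow> u \<le> (g ^^ n) u \<and> (g ^^ n) u < 1"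
proof (induction n)
  case (Suc n)
  then show ?case
    using above[of "(g ^^ n) u"] g_mono[of "(g ^^ n) u" 1] ends by auto
qed simp

lemma g_iterate_leaves:
  assumes "g 0 < u" "u < 1" "0 < n"
  shows "g (g 0) < (g ^^ n) u"
proof -
  obtain k where "n = Suc k" using assms by (cases n) auto
  then show ?thesis
    using g_iterate_ge[OF assms(1,2), of k] g_mono[of "g 0" "(g ^^ k) u"] assms ends by auto
qed

lemma f_iterate_le: "0 < u \<Longrightarrow> u < f 1 \<Longrightarrow> (f ^^ n) u \<le> u \<and> 0 < (f ^^ n) u"
proof (induction n)
  case (Suc n)
  then show ?case
    using below[of "(f ^^ n) u"] f_mono[of 0 "(f ^^ n) u"] ends by auto
qed simp

lemma f_iterate_leaves:
  assumes "0 < u" "u < f 1" "0 < n"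
  shows "(f ^^ n) u < f (f 1)"
proof -
  obtain k where "n = Suc k" using assms by (cases n) auto
  then show ?thesis
    using f_iterate_le[OF assms(1,2), of k] f_mono[of "(f ^^ k) u" "f 1"] assms ends by auto
qed

text \<open>
  The left endpoint \<open>g 0\<close> of \<open>G\<^sub>1\<close> is excluded for positive \<open>n\<close>: its image \<open>g (g 0)\<close> is in \<open>G\<^sub>1\<close> again, so that the
  backward orbit would stop one step earlier.
\<close>

lemma induced_F_branch:
  assumes "g 0 < u \<or> n = 0" "u \<in> {g 0..g (g 0)}"
  shows "induced_F f g (f ((g ^^ n) u)) = u"
proof -
  have u: "u \<in> {0..1}" "u < 1" using assms ends by auto
  have "(g ^^ j) u \<notin> G_ivl g 1" if "0 < j" "j \<le> n" for j
    using g_iterate_leaves[of u j] that assms u intervals by auto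
  then show ?thesis
    using first_entry_of_backward_orbit[of f g u "G_ivl g 1" n] Diff1_imD Diff1 u assms(2) intervals(2)
    unfolding induced_F_def n_time_def by simp
qed

lemma induced_G_branch:
  assumes "u < f 1 \<or> m = 0" "u \<in> {f (f 1)..f 1}"
  shows "induced_G f g (g ((f ^^ m) u)) = u"
proof -
  have u: "u \<in> {0..1}" "0 < u" using assms ends by auto
  have "(f ^^ j) u \<notin> F_ivl f 1" if "0 < j" "j \<le> m" for j
    using f_iterate_leaves[of u j] that assms u intervals by auto
  then show ?thesis
    using first_entry_of_backward_orbit[of g f u "F_ivl f 1" m] Diff1_imD Diff1 u assms(2) intervals(1)
    unfolding induced_G_def m_time_def by simp
qed

lemma f_image: "0 \<le> x \<Longrightarrow> x \<le> y \<Longrightarrow> y \<le> 1 \<Longrightarrow> f ` {x..y} = {f x..f y}"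
  using f_mono' IVT'[of f x _ y] continuous_on_subset[OF f_cont, of "{x..y}"] by fastforce

lemma g_image: "0 \<le> x \<Longrightarrow> x \<le> y \<Longrightarrow> y \<le> 1 \<Longrightarrow> g ` {x..y} = {g x..g y}"
  using g_mono' IVT'[of g x _ y] continuous_on_subset[OF g_cont, of "{x..y}"] by fastforce

text \<open>
  The half-open intervals \<open>(g\<^sup>n\<^sup>+\<^sup>1 0, g\<^sup>n\<^sup>+\<^sup>2 0]\<close> tile \<open>(g 0, 1)\<close>, which contains \<open>f\<^sup>-\<^sup>1 y\<close>. Together with
  the branch formula this determines \<open>\<F>\<close> on its whole domain.
\<close>

lemma dom_F_E:
  assumes "y \<in> dom_F f"
  obtains n u where "g 0 < u" "u \<le> g (g 0)" "f 1 \<le> (g ^^ n) u" "y = f ((g ^^ n) u)"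
proof -
  have "y \<in> f ` {f 1..1}" using assms f_image[of "f 1" 1] ends intervals by auto
  then obtain z where z: "f 1 \<le> z" "z \<le> 1" "y = f z" by auto
  moreover have "z \<noteq> 1" using assms z intervals by auto
  ultimately have "g 0 < z" "z < 1" using ends by auto
  then show thesis
    using fundamental_domain_above[OF g_cont g_im ends(2) above ends(3)] that z by metis
qed

lemma dom_G_E:
  assumes "y \<in> dom_G g"
  obtains m u where "f (f 1) \<le> u" "u < f 1" "(f ^^ m) u \<le> g 0" "y = g ((f ^^ m) u)"
proof -
  have "y \<in> g ` {0..g 0}" using assms g_image[of 0 "g 0"] ends intervals by auto
  then obtain z where z: "0 \<le> z" "z \<le> g 0" "y = g z" by auto
  moreover have "z \<noteq> 0" using assms z intervals by auto
  ultimately have "0 < z" "z < f 1" using ends by auto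
  then show thesis
    using fundamental_domain_below[OF f_cont f_im ends(1) below ends(5)] that z by metis
qed

end

section \<open>Pairs with a hole\<close>

text \<open>
  The points \<open>a < b\<close> and \<open>c < d\<close> are the endpoints of \<open>H\<^sub>f\<close> and \<open>H\<^sub>g\<close>, given as two cycles of period 2. The
  inequalities place \<open>H\<^sub>f\<close> between \<open>F\<^sub>1\<close>'s left endpoint and \<open>W\<close>, and \<open>H\<^sub>g\<close> between \<open>W\<close> and \<open>G\<^sub>1\<close>'s right
  endpoint.
\<close>

locale hole_pair = overlapping_pair +
  fixes a b c d :: real
  assumes order: "f (f 1) < a" "a < b" "b < g 0" "f 1 < c" "c < d" "d < g (g 0)"
    and cycle: "g a = c" "f c = a" "g b = d" "f d = b"
begin

lemma hole: "Ho f g {a..b} {c..d}"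
proof -
  have f: "f ` {c..d} = {a..b}" and g: "g ` {a..b} = {c..d}"
    using f_image[of c d] g_image[of a b] order ends cycle by auto
  have "{f (f 1)<..<g 0} \<subseteq> interior (F_ivl f 1 - W_ivl f g)"
    using ends by (intro interior_maximal) (auto simp: intervals simp del: One_nat_def)
  moreover have "{f 1<..<g (g 0)} \<subseteq> interior (G_ivl g 1 - W_ivl f g)"
    using ends by (intro interior_maximal) (auto simp: intervals simp del: One_nat_def)
  ultimately show ?thesis
    unfolding Ho_def using order f g by fastforce
qed

text \<open>
  With \<open>y = f (g\<^sup>n u)\<close> and \<open>u\<close> in \<open>G\<^sub>1\<close>, the points \<open>u, \<dots>, g\<^sup>n\<^sup>-\<^sup>1 u\<close> at which \<open>g\<close> is differentiated lie
  to the right of \<open>g 0\<close> and thus of \<open>H\<^sub>f\<close>. The point \<open>g\<^sup>n u\<close> at which \<open>f\<close> is differentiated is not in \<open>H\<^sub>g\<close>,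
  because \<open>f\<close> maps \<open>H\<^sub>g\<close> to \<open>H\<^sub>f\<close>.
\<close>

lemma induced_F_expanding:
  assumes f': "\<And>x. x \<in> {0..1} - {c..d} \<Longrightarrow> D01 f x \<le> \<kappa>"
    and g': "\<And>x. x \<in> {0..1} - {a..b} \<Longrightarrow> D01 g x \<le> 1"
    and y: "y \<in> dom_F f - {a..b}"
    and D: "(induced_F f g has_real_derivative D) (at y within dom_F f)"
  shows "1 / \<kappa> \<le> D"
proof -
  obtain n u where u: "g 0 < u" "u \<le> g (g 0)" "f 1 \<le> (g ^^ n) u" "y = f ((g ^^ n) u)"
    using dom_F_E y by blast
  \<comment> \<open>For positive \<open>n\<close> every point of \<open>G\<^sub>1\<close> beyond \<open>g 0\<close> is mapped by \<open>g\<^sup>n\<close> beyond \<open>f 1\<close>, so the branch extends to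
    the left of \<open>u\<close>. For \<open>n = 0\<close> the branch starts at \<open>f 1\<close>, which may be \<open>u\<close> itself, and then only the
    right side is available.\<close>
  define K where "K = (if n = 0 then {f 1..g (g 0)} else {g 0<..u})"
  have u01: "0 \<le> u" "u < 1" using u ends by auto
  have "u \<in> K" and "K \<subseteq> {g 0<..g (g 0)}"
    using u ends by (auto simp: K_def)
  moreover have "u islimpt K"
  proof (rule connected_imp_perfect)
    show "connected K" by (auto simp: K_def)
    show "K \<noteq> {x}" for x
    proof
      assume "K = {x}"
      then have "\<And>s t. s \<in> K \<Longrightarrow> t \<in> K \<Longrightarrow> s = t" by auto
      from this[of "f 1" "g (g 0)"] this[of u "(g 0 + u) / 2"] show False
        using u overlap ends by (cases "n = 0") (auto simp: K_def)
    qed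
  qed fact
  moreover have "f ((g ^^ n) v) \<in> dom_F f \<and> induced_F f g (f ((g ^^ n) v)) = v" if "v \<in> K" for v
  proof -
    have v: "g 0 < v" "v \<le> g (g 0)" "v < 1"
      using that \<open>K \<subseteq> _\<close> ends by auto
    have "f 1 \<le> (g ^^ n) v"
      using that g_iterate_leaves[of v n] v overlap by (auto simp: K_def split: if_splits)
    then show ?thesis
      using induced_F_branch[of v n] v g_iterate_ge[of v n] f_mono'[of "f 1" "(g ^^ n) v"]
        f_mono[of "(g ^^ n) v" 1] ends by (auto simp: intervals)
  qed
  moreover have w: "(g ^^ n) u \<in> {0..1}" using iterate_mem[of "{0..1}" g u n] g_im u01 by auto
  moreover have "(g ^^ n) u \<notin> {c..d}"
    using y u cycle f_image[of c d] order ends by auto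
  moreover have "0 < D01 g ((g ^^ j) u) \<and> D01 g ((g ^^ j) u) \<le> 1" for j
    using g_iterate_ge[of u j] u u01 order ends by (auto intro!: g_pos g')
  ultimately show ?thesis
    using D f' f_pos u ends
    by (intro inverse_branch_derivative_ge[OF Diff1, of K u n "dom_F f" "induced_F f g"]) auto
qed

lemma induced_G_expanding:
  assumes f': "\<And>x. x \<in> {0..1} - {c..d} \<Longrightarrow> D01 f x \<le> 1"
    and g': "\<And>x. x \<in> {0..1} - {a..b} \<Longrightarrow> D01 g x \<le> \<kappa>"
    and y: "y \<in> dom_G g - {c..d}"
    and D: "(induced_G f g has_real_derivative D) (at y within dom_G g)"
  shows "1 / \<kappa> \<le> D"
proof -
  obtain m u where u: "f (f 1) \<le> u" "u < f 1" "(f ^^ m) u \<le> g 0" "y = g ((f ^^ m) u)"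
    using dom_G_E y by blast
  \<comment> \<open>As for \<open>\<F>\<close>, with the sides exchanged.\<close>
  define K where "K = (if m = 0 then {f (f 1)..g 0} else {u..<f 1})"
  have u01: "0 < u" "u \<le> 1" using u ends by auto
  have "u \<in> K" and "K \<subseteq> {f (f 1)..<f 1}"
    using u ends by (auto simp: K_def)
  moreover have "u islimpt K"
  proof (rule connected_imp_perfect)
    show "connected K" by (auto simp: K_def)
    show "K \<noteq> {x}" for x
    proof
      assume "K = {x}"
      then have "\<And>s t. s \<in> K \<Longrightarrow> t \<in> K \<Longrightarrow> s = t" by auto
      from this[of "g 0" "f (f 1)"] this[of u "(f 1 + u) / 2"] show False
        using u overlap ends by (cases "m = 0") (auto simp: K_def)
    qed
  qed fact
  moreover have "g ((f ^^ m) v) \<in> dom_G g \<and> induced_G f g (g ((f ^^ m) v)) = v" if "v \<in> K" for v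
  proof -
    have v: "f (f 1) \<le> v" "v < f 1" "0 < v"
      using that \<open>K \<subseteq> _\<close> ends by auto
    have "(f ^^ m) v \<le> g 0"
      using that f_iterate_leaves[of v m] v overlap by (auto simp: K_def split: if_splits)
    then show ?thesis
      using induced_G_branch[of v m] v f_iterate_le[of v m] g_mono'[of "(f ^^ m) v" "g 0"]
        g_mono[of 0 "(f ^^ m) v"] ends by (auto simp: intervals)
  qed
  moreover have w: "(f ^^ m) u \<in> {0..1}" using iterate_mem[of "{0..1}" f u m] f_im u01 by auto
  moreover have "(f ^^ m) u \<notin> {a..b}"
    using y u cycle g_image[of a b] order ends by auto
  moreover have "0 < D01 f ((f ^^ j) u) \<and> D01 f ((f ^^ j) u) \<le> 1" for j
    using f_iterate_le[of u j] u u01 order ends by (auto intro!: f_pos f')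
  ultimately show ?thesis
    using D g' g_pos u ends
    by (intro inverse_branch_derivative_ge[OF Diff1(2) Diff1(1), of K u m "dom_G g" "induced_G f g"]) auto
qed

lemma eventual_expansion:
  assumes "\<kappa> < 1"
    and f': "\<And>x. x \<in> {0..1} - {c..d} \<Longrightarrow> D01 f x \<le> \<kappa>"
    and g': "\<And>x. x \<in> {0..1} - {a..b} \<Longrightarrow> D01 g x \<le> \<kappa>"
  shows "Ee f g {a..b} {c..d}"
proof -
  have "0 < \<kappa>" using f_pos[of 0] f'[of 0] order ends by auto
  then obtain \<mu> where \<mu>: "1 < \<mu>" "\<mu> < 1 / \<kappa>"
    using dense[of 1 "1 / \<kappa>"] \<open>\<kappa> < 1\<close> by auto
  have f1: "D01 f x \<le> 1" if "x \<in> {0..1} - {c..d}" for x using f'[OF that] \<open>\<kappa> < 1\<close> by simp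
  have g1: "D01 g x \<le> 1" if "x \<in> {0..1} - {a..b}" for x using g'[OF that] \<open>\<kappa> < 1\<close> by simp
  show ?thesis
    unfolding Ee_def using \<mu> induced_F_expanding[OF f' g1] induced_G_expanding[OF f1 g']
    by (intro exI[of _ \<mu>]) (auto intro: less_le_trans)
qed

text \<open>This is the interior of \<open>f (g H\<^sub>g)\<close>, where the branch of \<open>\<F>\<close> with \<open>n = 1\<close> takes values in \<open>H\<^sub>g\<close>.\<close>

lemma R_f_contains: "{f (g c)<..<f (g d)} \<subseteq> interior (R_f f g {c..d})"
proof (rule interior_maximal)
  show "{f (g c)<..<f (g d)} \<subseteq> R_f f g {c..d}"
  proof
    fix t assume t: "t \<in> {f (g c)<..<f (g d)}"
    have gc: "0 \<le> g c" "g c \<le> g d" "g d \<le> 1"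
      using g_im[of c] g_im[of d] g_mono'[of c d] order ends by auto
    have "t \<in> f ` {g c..g d}" using t f_image[OF gc] by auto
    also have "{g c..g d} = g ` {c..d}" using g_image[of c d] order ends by auto
    finally obtain s where s: "s \<in> {c..d}" "t = f (g s)" by auto
    have "f 1 \<le> g s" "g s < 1"
      using g_iterate_leaves[of s 1] g_iterate_ge[of s 1] s order ends overlap by auto
    then have "t \<in> dom_F f"
      using f_mono'[of "f 1" "g s"] f_mono[of "g s" 1] s ends by (auto simp: intervals)
    moreover have "induced_F f g t = s"
      using induced_F_branch[of s 1] s order ends by auto
    ultimately show "t \<in> R_f f g {c..d}" using s by (auto simp: R_f_def)
  qed
qed simp

lemma R_g_contains: "{g (f a)<..<g (f b)} \<subseteq> interior (R_g f g {a..b})"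
proof (rule interior_maximal)
  show "{g (f a)<..<g (f b)} \<subseteq> R_g f g {a..b}"
  proof
    fix t assume t: "t \<in> {g (f a)<..<g (f b)}"
    have fa: "0 \<le> f a" "f a \<le> f b" "f b \<le> 1"
      using f_im[of a] f_im[of b] f_mono'[of a b] order ends by auto
    have "t \<in> g ` {f a..f b}" using t g_image[OF fa] by auto
    also have "{f a..f b} = f ` {a..b}" using f_image[of a b] order ends by auto
    finally obtain s where s: "s \<in> {a..b}" "t = g (f s)" by auto
    have "f s \<le> g 0" "0 < f s"
      using f_iterate_leaves[of s 1] f_iterate_le[of s 1] s order ends overlap by auto
    then have "t \<in> dom_G g"
      using g_mono'[of "f s" "g 0"] g_mono[of 0 "f s"] s ends by (auto simp: intervals)
    moreover have "induced_G f g t = s"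
      using induced_G_branch[of s 1] s order ends by auto
    ultimately show "t \<in> R_g f g {a..b}" using s by (auto simp: R_g_def)
  qed
qed simp

text \<open>
  The first interval contains the left endpoint of \<open>W\<close>, the second one the right endpoint, and the
  third inequality says that they overlap.
\<close>

lemma castration:
  assumes "f (g c) < g 0" "f 1 < g (f b)" "g (f a) < f (g d)"
  shows "Ca f g {a..b} {c..d}"
proof -
  have "{g 0..f 1} \<subseteq> {f (g c)<..<f (g d)} \<union> {g (f a)<..<g (f b)}"
    using assms by auto
  then show ?thesis
    unfolding Ca_def intervals using R_f_contains R_g_contains by blast
qed

lemma in_C_pairs:
  assumes "\<kappa> < 1"
    and "\<And>x. x \<in> {0..1} - {c..d} \<Longrightarrow> D01 f x \<le> \<kappa>"
    and "\<And>x. x \<in> {0..1} - {a..b} \<Longrightarrow> D01 g x \<le> \<kappa>"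
    and "f (g c) < g 0" "f 1 < g (f b)" "g (f a) < f (g d)"
  shows "(f, g) \<in> C_pairs"
  unfolding C_pairs_def
  using A hole eventual_expansion[OF assms(1-3)] castration[OF assms(4-6)] So_iff[OF A] overlap
  by auto

end



section \<open>The model pair\<close>

text \<open>
  A map with positive derivative on the whole line has an inverse that is differentiable on an
  open neighbourhood of the image of \<open>[0, 1]\<close>, which settles the one-sided derivatives at the endpoints. The
  interval \<open>[-1, 2]\<close> serves as a compact neighbourhood of \<open>[0, 1]\<close>, where continuity of the inverse is
  automatic.
\<close>

lemma restrict_in_Diff1_im:
  fixes F F' :: "real \<Rightarrow> real"
  assumes deriv: "\<And>x. (F has_real_derivative F' x) (at x)" and pos: "\<And>x. 0 < F' x"
    and cont: "continuous_on UNIV F'" and ends: "0 \<le> F 0" "F 1 \<le> 1"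
  shows "restrict F {0..1} \<in> Diff1_im"
    and "\<And>x. x \<in> {0..1} \<Longrightarrow> D01 (restrict F {0..1}) x = F' x"
proof -
  let ?f = "restrict F {0..1}"
  have mono: "F x < F y" if "x < y" for x y
    using that deriv pos by (meson DERIV_pos_imp_increasing)
  then have "strict_mono F" by (rule strict_monoI)
  have contF: "continuous_on X F" for X
    using deriv DERIV_isCont continuous_at_imp_continuous_on by blast
  have inj: "inj_on F X" for X
    using \<open>strict_mono F\<close> by (simp add: strict_mono_on_imp_inj_on strict_mono_imp_inj_on inj_on_subset)
  have f': "(?f has_real_derivative F' x) (at x within {0..1})" if "x \<in> {0..1}" for x
    by (rule has_field_derivative_transform[OF that _ has_field_derivative_at_within[OF deriv]]) simp
  then show "D01 ?f x = F' x" if "x \<in> {0..1}" for x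
    using D01_eqI that by blast
  have image: "F ` {x..y} = {F x..F y}" if "x \<le> y" for x y
    using that \<open>strict_mono F\<close>[THEN strict_mono_mono, THEN monoD] IVT'[OF _ _ _ contF, of x _ y]
    by fastforce
  have "C1_on {0..1} ?f"
    unfolding C1_on_def using f' continuous_on_subset[OF cont] by blast
  moreover have "C1_on (?f ` {0..1}) (inv01 ?f)"
  proof -
    define G where "G = inv_into {-1..2} F"
    have GF: "G (F x) = x" if "x \<in> {-1..2}" for x
      unfolding G_def using inj that by simp
    have contG: "continuous_on {F (-1)..F 2} G"
      unfolding G_def image[of "-1" 2, simplified, symmetric]
      using GF by (intro continuous_on_inv contF compact_Icc) (auto simp: G_def)
    have inv: "inv01 ?f y = G y" if "y \<in> ?f ` {0..1}" for y
    proof -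
      obtain x where x: "x \<in> {0..1}" "y = F x" using \<open>y \<in> _\<close> by auto
      moreover have "inj_on ?f {0..1}" using inj by simp
      ultimately show ?thesis
        using inv_into_f_f[of ?f "{0..1}" x] GF[of x] by auto
    qed
    have G': "(G has_real_derivative inverse (F' x)) (at (F x))" if x: "x \<in> {0..1}" for x
    proof (rule DERIV_inverse_function)
      show "F (-1) < F x" "F x < F 2" using x mono by auto
      show "(F has_real_derivative F' x) (at (G (F x)))" using x GF deriv by simp
      show "F' x \<noteq> 0" using pos[of x] by simp
      show "F (G y) = y" if "F (-1) < y" "y < F 2" for y
        using image[of "-1" 2] that unfolding G_def by (intro f_inv_into_f) auto
      show "isCont G (F x)"
        using contG \<open>F (-1) < F x\<close> \<open>F x < F 2\<close> by (auto intro: continuous_on_interior)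
    qed
    have "(inv01 ?f has_real_derivative inverse (F' (G y))) (at y within ?f ` {0..1})"
      if y: "y \<in> ?f ` {0..1}" for y
    proof (rule has_field_derivative_transform[OF y])
      obtain x where x: "x \<in> {0..1}" "y = F x" using y by auto
      then show "(G has_real_derivative inverse (F' (G y))) (at y within ?f ` {0..1})"
        using G'[of x] GF[of x] by (auto intro: has_field_derivative_at_within)
    qed (rule inv)
    moreover have "continuous_on (?f ` {0..1}) (\<lambda>y. inverse (F' (G y)))"
    proof (rule continuous_on_inverse)
      have "F (-1) < F 0" "F 1 < F 2" by (simp_all add: mono)
      then have "?f ` {0..1} \<subseteq> {F (-1)..F 2}" using image[of 0 1] by auto
      then have "continuous_on (?f ` {0..1}) G" by (rule continuous_on_subset[OF contG])
      then show "continuous_on (?f ` {0..1}) (\<lambda>y. F' (G y))"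
        by (rule continuous_on_compose2[OF cont]) simp
      show "\<forall>y\<in>?f ` {0..1}. F' (G y) \<noteq> 0" by (intro ballI less_imp_neq[symmetric] pos)
    qed
    ultimately show ?thesis
      unfolding C1_on_def by (intro exI[of _ "\<lambda>y. inverse (F' (G y))"] conjI ballI)
  qed
  moreover have "?f ` {0..1} \<subseteq> {0..1}" using image[of 0 1] ends by auto
  moreover have "inj_on ?f {0..1}" using inj by simp
  ultimately show "?f \<in> Diff1_im" unfolding Diff1_im_def by blast
qed

definition ramp :: "real \<Rightarrow> real" where
  "ramp t = (max 0 t)\<^sup>2"

lemma ramp_deriv: "(ramp has_real_derivative 2 * max 0 t) (at t)"
proof -
  consider "t < 0" | "t = 0" | "0 < t" by linarith
  then show ?thesis
  proof cases
    case 1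
    then have ev: "\<forall>\<^sub>F x in nhds t. ramp x = 0"
      by (intro eventually_mono[OF eventually_nhds_in_open[of "{..<0}"]]) (auto simp: ramp_def)
    show ?thesis by (subst DERIV_cong_ev[OF refl ev refl]) (use 1 in auto)
  next
    case 3
    then have ev: "\<forall>\<^sub>F x in nhds t. ramp x = x\<^sup>2"
      by (intro eventually_mono[OF eventually_nhds_in_open[of "{0<..}"]]) (auto simp: ramp_def)
    show ?thesis by (subst DERIV_cong_ev[OF refl ev refl]) (use 3 in \<open>auto intro!: derivative_eq_intros\<close>)
  next
    case 2
    have "((\<lambda>x. ramp x / x) \<longlongrightarrow> 0) (at 0)"
    proof (rule Lim_null_comparison)
      show "\<forall>\<^sub>F x in at 0. norm (ramp x / x) \<le> \<bar>x\<bar>"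
        by (auto simp: ramp_def max_def power2_eq_square)
      show "((\<lambda>x::real. \<bar>x\<bar>) \<longlongrightarrow> 0) (at 0)" by (rule tendsto_rabs_zero[OF tendsto_ident_at])
    qed
    then show ?thesis using 2 by (simp add: has_field_derivative_iff ramp_def)
  qed
qed

text \<open>
  The second difference of the \<open>C\<^sup>1\<close> function \<open>ramp\<close> is a \<open>C\<^sup>1\<close> step: it vanishes to the left of \<open>6/10\<close>, is
  the constant \<open>2 / 100\<close> to the right of \<open>8/10\<close>, and has a tent as derivative. The factor 13 makes the step
  equal to \<open>26/100\<close>, so that the model takes the value \<open>51/100\<close> at 1.
\<close>

definition model :: "real \<Rightarrow> real" where
  "model x = x / 4 + 13 * (ramp (x - 6/10) - 2 * ramp (x - 7/10) + ramp (x - 8/10))"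

definition model' :: "real \<Rightarrow> real" where
  "model' x = 1/4 + 26 * (max 0 (x - 6/10) - 2 * max 0 (x - 7/10) + max 0 (x - 8/10))"

lemma model_deriv: "(model has_real_derivative model' x) (at x)"
proof -
  have "((\<lambda>x. ramp (x - s)) has_real_derivative 2 * max 0 (x - s)) (at x)" for s
  proof -
    have "((\<lambda>x. x - s) has_real_derivative 1) (at x)" by (auto intro!: derivative_eq_intros)
    from DERIV_chain2[OF ramp_deriv this] show ?thesis by simp
  qed
  then show ?thesis
    unfolding model_def[abs_def] model'_def by (auto intro!: derivative_eq_intros)
qed

lemma model_left: "x \<le> 6/10 \<Longrightarrow> model x = x / 4" 
  by (simp add: model_def ramp_def)

lemma model_right: "8/10 \<le> x \<Longrightarrow> model x = x / 4 + 26/100"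
  by (simp add: model_def ramp_def power2_eq_square field_simps)

lemma model'_ge: "1/4 \<le> model' x"
  by (simp add: model'_def max_def)

lemma model'_out: "x \<notin> {6/10..8/10} \<Longrightarrow> model' x = 1/4"
  by (auto simp: model'_def max_def)

lemma model_less: "0 < x \<Longrightarrow> model x < x"
proof -
  assume x: "0 < x"
  \<comment> \<open>The step part is nondecreasing, so it is at most its final value \<open>26/100\<close>, which is less than \<open>3 x / 4\<close> for
    \<open>x > 6/10\<close>.\<close>
  have mono: "s \<le> t \<Longrightarrow> model s - s / 4 \<le> model t - t / 4" for s t
    by (rule DERIV_nonneg_imp_nondecreasing[of s t "\<lambda>x. model x - x / 4"])
      (use model'_ge in \<open>force intro!: derivative_eq_intros model_deriv\<close>)+
  show ?thesis
  proof (cases "x \<le> 6/10")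
    case False
    then show ?thesis using mono[of x "max x (8/10)"] model_right[of "max x (8/10)"] by auto
  qed (use x model_left[of x] in auto)
qed

definition model_f :: "real \<Rightarrow> real" where "model_f = restrict model {0..1}"
definition model_g :: "real \<Rightarrow> real" where "model_g = restrict (\<lambda>x. 1 - model (1 - x)) {0..1}"

lemma model_cont: "continuous_on UNIV model'"
  unfolding model'_def by (intro continuous_intros)

lemma model_f_Diff1: "model_f \<in> Diff1_im" and D01_model_f: "x \<in> {0..1} \<Longrightarrow> D01 model_f x = model' x"
  unfolding model_f_def
  using restrict_in_Diff1_im[of model model', OF model_deriv less_le_trans[OF _ model'_ge] model_cont]
  by (auto simp: model_left model_right)

lemma model_g_Diff1: "model_g \<in> Diff1_im" and D01_model_g: "x \<in> {0..1} \<Longrightarrow> D01 model_g x = model' (1 - x)"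
proof -
  have d: "((\<lambda>x. 1 - model (1 - x)) has_real_derivative model' (1 - x)) (at x)" for x
  proof -
    have "((\<lambda>x. 1 - x) has_real_derivative -1) (at x)" by (auto intro!: derivative_eq_intros)
    from DERIV_chain2[OF model_deriv this] show ?thesis by (auto intro!: derivative_eq_intros)
  qed
  have c: "continuous_on UNIV (\<lambda>x. model' (1 - x))"
    by (intro continuous_on_compose2[OF model_cont] continuous_intros) auto
  note * = restrict_in_Diff1_im[of "\<lambda>x. 1 - model (1 - x)" "\<lambda>x. model' (1 - x)", OF d less_le_trans[OF _ model'_ge] c]
  show "model_g \<in> Diff1_im" "x \<in> {0..1} \<Longrightarrow> D01 model_g x = model' (1 - x)"
    unfolding model_g_def using * by (auto simp: model_left model_right)
qed

lemma model_values:
  "x \<in> {0..6/10} \<Longrightarrow> model_f x = x / 4"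
  "x \<in> {8/10..1} \<Longrightarrow> model_f x = x / 4 + 26/100"
  "x \<in> {0..2/10} \<Longrightarrow> model_g x = x / 4 + 49/100"
  "x \<in> {4/10..1} \<Longrightarrow> model_g x = x / 4 + 75/100"
  using model_left[of x] model_right[of x] model_left[of "1 - x"] model_right[of "1 - x"]
  by (auto simp: model_f_def model_g_def diff_divide_distrib)

lemma model_pair: "(model_f, model_g) \<in> A_pairs"
proof -
  have "model_f x < x" "x < model_g x" if "x \<in> {0<..<1}" for x
    using that model_less[of x] model_less[of "1 - x"] by (auto simp: model_f_def model_g_def)
  then show ?thesis
    unfolding A_pairs_def using model_f_Diff1 model_g_Diff1
    by (auto simp: model_f_def model_g_def model_left model_right)
qed

lemma C1_dist_less_D:
  assumes "f \<in> Diff1_im" "h \<in> Diff1_im" "C1_dist f h < \<delta>" "x \<in> {0..1}"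
  shows "h x \<in> {f x - \<delta><..<f x + \<delta>}" "D01 h x \<in> {D01 f x - \<delta><..<D01 f x + \<delta>}"
proof -
  note c = Diff1_im_continuous[OF assms(1)] Diff1_im_continuous[OF assms(2)]
  have "\<bar>f x - h x\<bar> \<le> (SUP x\<in>{0..1}. \<bar>f x - h x\<bar>)"
    "\<bar>D01 f x - D01 h x\<bar> \<le> (SUP x\<in>{0..1}. \<bar>D01 f x - D01 h x\<bar>)"
    using cSUP_upper[OF assms(4) bdd_above_abs_diff] c by auto
  moreover have "0 \<le> (SUP x\<in>{0..1}. \<bar>f x - h x\<bar>)" "0 \<le> (SUP x\<in>{0..1}. \<bar>D01 f x - D01 h x\<bar>)"
    using SUP_abs_diff_nonneg c by auto
  ultimately have "\<bar>f x - h x\<bar> < \<delta>" "\<bar>D01 f x - D01 h x\<bar> < \<delta>"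
    using assms unfolding C1_dist_def by auto
  then show "h x \<in> {f x - \<delta><..<f x + \<delta>}" "D01 h x \<in> {D01 f x - \<delta><..<D01 f x + \<delta>}"
    unfolding abs_less_iff by auto
qed

section \<open>A neighbourhood of the model pair\<close>

text \<open>Brouwer's theorem in dimension 1, applied to \<open>f \<circ> g\<close>.\<close>

lemma two_cycle_exists:
  fixes f g :: "real \<Rightarrow> real"
  assumes "l \<le> r" "continuous_on {l..r} g" "continuous_on S f"
    and "\<And>x. x \<in> {l..r} \<Longrightarrow> g x \<in> S" "\<And>y. y \<in> S \<Longrightarrow> f y \<in> {l..r}"
  obtains x where "x \<in> {l..r}" "g x \<in> S" "f (g x) = x"
proof -
  have "continuous_on {l..r} (\<lambda>x. f (g x))"
    using assms by (intro continuous_on_compose2[OF assms(3)]) auto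
  then obtain x where "x \<in> {l..r}" "f (g x) = x"
    using brouwer[of "{l..r}" "\<lambda>x. f (g x)"] assms by auto
  then show thesis using that assms(4) by blast
qed

text \<open>
  Off the step, the maps are within \<open>1/10000\<close> of affine maps of slope \<open>1/4\<close>, and
  every value that the criterion compares is taken at such a point. Around the cycles of the model,
  the windows \<open>[130/1000, 131/1000]\<close>, \<open>[477/1000, 478/1000]\<close> and their mirror images are wide enough for
  the contraction by \<open>1/4\<close> to absorb the perturbation.
\<close>

lemma near_model_in_C_pairs:
  assumes A: "(f, g) \<in> A_pairs" and near: "C1_dist model_f f < 1/10000" "C1_dist model_g g < 1/10000"
  shows "(f, g) \<in> C_pairs"
proof -
  have D: "f \<in> Diff1_im" "g \<in> Diff1_im" using A by (auto simp: A_pairs_def)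
  note bf = C1_dist_less_D[OF model_f_Diff1 D(1) near(1)]
    and bg = C1_dist_less_D[OF model_g_Diff1 D(2) near(2)]
  have f_left: "f x \<in> {x / 4 - 1/10000<..<x / 4 + 1/10000}" if "x \<in> {0..6/10}" for x
    using bf(1)[of x] that model_values(1)[of x] by auto
  have f_right: "f x \<in> {x / 4 + 26/100 - 1/10000<..<x / 4 + 26/100 + 1/10000}"
    if "x \<in> {8/10..1}" for x
    using bf(1)[of x] that model_values(2)[of x] by auto
  have g_left: "g x \<in> {x / 4 + 49/100 - 1/10000<..<x / 4 + 49/100 + 1/10000}"
    if "x \<in> {0..2/10}" for x
    using bg(1)[of x] that model_values(3)[of x] by auto
  have g_right: "g x \<in> {x / 4 + 75/100 - 1/10000<..<x / 4 + 75/100 + 1/10000}"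
    if "x \<in> {4/10..1}" for x
    using bg(1)[of x] that model_values(4)[of x] by auto
  have f_one: "5099/10000 < f 1" "f 1 < 5101/10000" and g_zero: "4899/10000 < g 0" "g 0 < 4901/10000"
    using f_right[of 1] g_left[of 0] by auto
  have ff: "f (f 1) < 13/100" and gg: "87/100 < g (g 0)"
    using f_left[of "f 1"] g_right[of "g 0"] f_one g_zero by auto
  have pos: "0 < D01 f x" "0 < D01 g x" if "x \<in> {0..1}" for x
    using bf(2)[OF that] bg(2)[OF that] model'_ge[of x] model'_ge[of "1 - x"] D01_model_f[OF that] D01_model_g[OF that]
    by auto
  have cont: "X \<subseteq> {0..1} \<Longrightarrow> continuous_on X f" "X \<subseteq> {0..1} \<Longrightarrow> continuous_on X g" for X
    using Diff1_im_continuous D continuous_on_subset by blast+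
  obtain a where a: "a \<in> {130/1000..131/1000}" "g a \<in> {522/1000..523/1000}" "f (g a) = a"
  proof (rule two_cycle_exists[of "130/1000" "131/1000" g "{522/1000..523/1000}" f])
    show "g x \<in> {522/1000..523/1000}" if "x \<in> {130/1000..131/1000}" for x
      using g_left[of x] that by auto
    show "f x \<in> {130/1000..131/1000}" if "x \<in> {522/1000..523/1000}" for x
      using f_left[of x] that by auto
  qed (auto intro!: cont)
  obtain b where b: "b \<in> {477/1000..478/1000}" "g b \<in> {869/1000..870/1000}" "f (g b) = b"
  proof (rule two_cycle_exists[of "477/1000" "478/1000" g "{869/1000..870/1000}" f])
    show "g x \<in> {869/1000..870/1000}" if "x \<in> {477/1000..478/1000}" for x
      using g_right[of x] that by auto
    show "f x \<in> {477/1000..478/1000}" if "x \<in> {869/1000..870/1000}" for x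
      using f_right[of x] that by auto
  qed (auto intro!: cont)
  interpret hole_pair f g a b "g a" "g b"
    by unfold_locales (use A pos ff gg f_one g_zero a b in auto)
  show ?thesis
  \<comment> \<open>Off the step the derivatives are below \<open>1/4 + 1/10000\<close>; \<open>1/2\<close> is a convenient bound below 1.\<close>
  proof (rule in_C_pairs[of "1/2"])
    show "D01 f x \<le> 1/2" if "x \<in> {0..1} - {g a..g b}" for x
      using bf(2)[of x] D01_model_f[of x] model'_out[of x] that a b by auto
    show "D01 g x \<le> 1/2" if "x \<in> {0..1} - {a..b}" for x
      using bg(2)[of x] D01_model_g[of x] model'_out[of "1 - x"] that a b by auto
    show "f (g (g a)) < g 0"
      using g_right[of "g a"] f_right[of "g (g a)"] a g_zero by auto
    show "f 1 < g (f b)"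
      using f_left[of b] g_left[of "f b"] b f_one by auto
    show "g (f a) < f (g (g b))"
      using f_left[of a] g_left[of "f a"] a g_right[of "g b"] f_right[of "g (g b)"] b
      by auto
  qed simp
qed

theorem proposition3:
  shows "subtopology (prod_topology C1_topology C1_topology) A_pairs interior_of C_pairs \<noteq> {}"
proof -
  interpret Metric_space Diff1_im C1_dist by (rule Metric_space_C1)
  let ?U = "A_pairs \<inter> (mball model_f (1/10000) \<times> mball model_g (1/10000))"
  have "openin (prod_topology C1_topology C1_topology) (mball model_f (1/10000) \<times> mball model_g (1/10000))"
    unfolding C1_topology_def by (simp add: openin_prod_Times_iff)
  then have "openin (subtopology (prod_topology C1_topology C1_topology) A_pairs) ?U"
    by (rule openin_subtopology_Int2)
  moreover have "?U \<subseteq> C_pairs" using near_model_in_C_pairs by auto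
  ultimately have "?U \<subseteq> subtopology (prod_topology C1_topology C1_topology) A_pairs interior_of C_pairs"
    by (intro interior_of_maximal)
  moreover have "(model_f, model_g) \<in> ?U" using model_pair model_f_Diff1 model_g_Diff1 by simp
  ultimately show ?thesis by blast
qed

end
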